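(* Suppose $\Lambda$ is a row-finite locally convex $k$-graph. Then $\Lambda$ is cofinal if and only if for every $v,w\in\Lambda^0$ there exists $n\in\mathbb{N}^k$ such that $v\Lambda s(\alpha)\neq\emptyset$ for each $\alpha\in w\Lambda^{\le n}$.
   Context: Conventions. $\mathbb{N}$ contains $0$, $k\ge 1$ is an integer, $\mathbb{N}^k$ is ordered coordinatewise, $e_i$ is its $i$th generator, and $m\vee n$, $m\wedge n$ denote the coordinatewise maximum and minimum. A $k$-graph $(\Lambda,d)$ is a countable small category $\Lambda$ (identified with its set of morphisms, called paths) with a functor $d:\Lambda\to\mathbb{N}^k$ satisfying the factorisation property: whenever $d(\lambda)=m+n$ there exist unique $\mu,\nu\in\Lambda$ with $d(\mu)=m$, $d(\nu)=n$ and $\lambda=\mu\nu$. Write $\Lambda^n=\{\lambda\in\Lambda: d(\lambda)=n\}$. Objects are identified with their identity morphisms, which form $\Lambda^0$ (the vertices). $r(\lambda),s(\lambda)\in\Lambda^0$ are the unique vertices with $\lambda=r(\lambda)\lambda=\lambda s(\lambda)$; the product $\mu\nu$ is defined exactly when $s(\mu)=r(\nu)$. For $m\le n\le d(\lambda)$, $\lambda(m,n)$ is the unique path in $\Lambda^{n-m}$ with $\lambda=\lambda'\lambda(m,n)\lambda''$, $d(\lambda')=m$, $d(\lambda'')=d(\lambda)-n$. For $v,w\in\Lambda^0$ and $X\subseteq\Lambda$: $vX=\{\lambda\in X:r(\lambda)=v\}$, $v\Lambda w=\{\lambda\in\Lambda:r(\lambda)=v,\ s(\lambda)=w\}$. For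 $n\in\mathbb{N}^k$, $\Lambda^{\le n}=\{\lambda\in\Lambda: d(\lambda)\le n,\text{ and } d(\lambda)_i<n_i\Rightarrow s(\lambda)\Lambda^{e_i}=\emptyset\}$. $\Lambda$ is row-finite if $v\Lambda^n$ is finite for all $v\in\Lambda^0$, $n\in\mathbb{N}^k$. $\Lambda$ is locally convex if for all $v\in\Lambda^0$, $i\neq j$, $\lambda\in v\Lambda^{e_i}$ and $\mu\in v\Lambda^{e_j}$, both $s(\lambda)\Lambda^{e_j}$ and $s(\mu)\Lambda^{e_i}$ are nonempty. For $\mu,\nu\in\Lambda$, $\operatorname{MCE}(\mu,\nu)=\{\lambda\in\Lambda: d(\lambda)=d(\mu)\vee d(\nu),\ \lambda(0,d(\mu))=\mu,\ \lambda(0,d(\nu))=\nu\}$. A set $E\subseteq v\Lambda$ is exhaustive if for every $\mu\in v\Lambda$ there is $\lambda\in E$ with $\operatorname{MCE}(\mu,\lambda)\neq\emptyset$; $v\operatorname{FE}(\Lambda)$ is the set of finite exhaustive subsets of $v\Lambda$. $\Lambda$ is cofinal if for all $v,w\in\Lambda^0$ there exists $E\in w\operatorname{FE}(\Lambda)$ such that $v\Lambda s(\alpha)\neq\emptyset$ for every $\alpha\in E$. *)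

theory Defs
  imports Complex_Main "HOL-Library.Function_Algebras" "HOL-Library.Countable_Set"
begin

(* The monoid of degrees is the function type 'k => nat for a finite index type 'k, whose
   cardinality is the rank (hence at least 1).  Sum, zero, order, sup and inf on it are the
   pointwise ones.

   A small category is given by its morphisms alone: an object is identified with its
   identity morphism, so rng and src are maps from paths to paths.  The composite
   x \<cdot> y is meaningful only when src x = rng y. *)

record ('a, 'k) path_category =
  paths :: "'a set"
  rng :: "'a \<Rightarrow> 'a"
  src :: "'a \<Rightarrow> 'a"
  path_comp :: "'a \<Rightarrow> 'a \<Rightarrow> 'a"  (infixl "\<cdot>\<index>" 70)
  degree :: "'a \<Rightarrow> ('k \<Rightarrow> nat)"

locale k_graph =
  fixes \<Lambda> :: "('a, 'k::finite) path_category" (structure)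
  assumes countable_paths: "countable (paths \<Lambda>)"
    and rng_closed: "x \<in> paths \<Lambda> \<Longrightarrow> rng \<Lambda> x \<in> paths \<Lambda>"
    and src_closed: "x \<in> paths \<Lambda> \<Longrightarrow> src \<Lambda> x \<in> paths \<Lambda>"
    and rng_rng: "x \<in> paths \<Lambda> \<Longrightarrow> rng \<Lambda> (rng \<Lambda> x) = rng \<Lambda> x"
    and src_rng: "x \<in> paths \<Lambda> \<Longrightarrow> src \<Lambda> (rng \<Lambda> x) = rng \<Lambda> x"
    and rng_src: "x \<in> paths \<Lambda> \<Longrightarrow> rng \<Lambda> (src \<Lambda> x) = src \<Lambda> x"
    and src_src: "x \<in> paths \<Lambda> \<Longrightarrow> src \<Lambda> (src \<Lambda> x) = src \<Lambda> x"
    and comp_closed: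
      "\<lbrakk>x \<in> paths \<Lambda>; y \<in> paths \<Lambda>; src \<Lambda> x = rng \<Lambda> y\<rbrakk> \<Longrightarrow> x \<cdot> y \<in> paths \<Lambda>"
    and rng_comp:
      "\<lbrakk>x \<in> paths \<Lambda>; y \<in> paths \<Lambda>; src \<Lambda> x = rng \<Lambda> y\<rbrakk> \<Longrightarrow> rng \<Lambda> (x \<cdot> y) = rng \<Lambda> x"
    and src_comp:
      "\<lbrakk>x \<in> paths \<Lambda>; y \<in> paths \<Lambda>; src \<Lambda> x = rng \<Lambda> y\<rbrakk> \<Longrightarrow> src \<Lambda> (x \<cdot> y) = src \<Lambda> y"
    and comp_assoc:
      "\<lbrakk>x \<in> paths \<Lambda>; y \<in> paths \<Lambda>; z \<in> paths \<Lambda>; src \<Lambda> x = rng \<Lambda> y; src \<Lambda> y = rng \<Lambda> z\<rbrakk>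
        \<Longrightarrow> (x \<cdot> y) \<cdot> z = x \<cdot> (y \<cdot> z)"
    and rng_comp_id: "x \<in> paths \<Lambda> \<Longrightarrow> rng \<Lambda> x \<cdot> x = x"
    and comp_src_id: "x \<in> paths \<Lambda> \<Longrightarrow> x \<cdot> src \<Lambda> x = x"
    and degree_id: "x \<in> paths \<Lambda> \<Longrightarrow> degree \<Lambda> (rng \<Lambda> x) = 0"
    and degree_comp:
      "\<lbrakk>x \<in> paths \<Lambda>; y \<in> paths \<Lambda>; src \<Lambda> x = rng \<Lambda> y\<rbrakk>
        \<Longrightarrow> degree \<Lambda> (x \<cdot> y) = degree \<Lambda> x + degree \<Lambda> y"
    and factorisation:
      "\<lbrakk>x \<in> paths \<Lambda>; degree \<Lambda> x = m + n\<rbrakk> \<Longrightarrow>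
        \<exists>!(\<mu>, \<nu>). \<mu> \<in> paths \<Lambda> \<and> \<nu> \<in> paths \<Lambda> \<and> src \<Lambda> \<mu> = rng \<Lambda> \<nu> \<and>
          degree \<Lambda> \<mu> = m \<and> degree \<Lambda> \<nu> = n \<and> x = \<mu> \<cdot> \<nu>"

definition basis_deg :: "'k \<Rightarrow> ('k \<Rightarrow> nat)" where
  "basis_deg i = (\<lambda>j. if j = i then 1 else 0)"

definition paths_deg :: "('a, 'k) path_category \<Rightarrow> ('k \<Rightarrow> nat) \<Rightarrow> 'a set" where
  "paths_deg \<Lambda> n = {x \<in> paths \<Lambda>. degree \<Lambda> x = n}"

abbreviation vertices :: "('a, 'k) path_category \<Rightarrow> 'a set" where
  "vertices \<Lambda> \<equiv> paths_deg \<Lambda> 0"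

definition with_rng :: "('a, 'k) path_category \<Rightarrow> 'a \<Rightarrow> 'a set \<Rightarrow> 'a set" where
  "with_rng \<Lambda> v X = {x \<in> X. rng \<Lambda> x = v}"

definition paths_between :: "('a, 'k) path_category \<Rightarrow> 'a \<Rightarrow> 'a \<Rightarrow> 'a set" where
  "paths_between \<Lambda> v w = {x \<in> paths \<Lambda>. rng \<Lambda> x = v \<and> src \<Lambda> x = w}"

definition paths_le :: "('a, 'k) path_category \<Rightarrow> ('k \<Rightarrow> nat) \<Rightarrow> 'a set" where
  "paths_le \<Lambda> n = {x \<in> paths \<Lambda>. degree \<Lambda> x \<le> n \<and>
     (\<forall>i. degree \<Lambda> x i < n i \<longrightarrow> with_rng \<Lambda> (src \<Lambda> x) (paths_deg \<Lambda> (basis_deg i)) = {})}"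

(* Only meaningful for m \<le> n \<le> degree \<Lambda> x; see segment_unique below. *)
definition segment :: "('a, 'k) path_category \<Rightarrow> 'a \<Rightarrow> ('k \<Rightarrow> nat) \<Rightarrow> ('k \<Rightarrow> nat) \<Rightarrow> 'a" where
  "segment \<Lambda> x m n = (THE y. y \<in> paths_deg \<Lambda> (n - m) \<and>
     (\<exists>x' \<in> paths_deg \<Lambda> m. \<exists>x'' \<in> paths_deg \<Lambda> (degree \<Lambda> x - n).
        src \<Lambda> x' = rng \<Lambda> y \<and> src \<Lambda> y = rng \<Lambda> x'' \<and>
        x = x' \<cdot>\<^bsub>\<Lambda>\<^esub> y \<cdot>\<^bsub>\<Lambda>\<^esub> x''))"

definition row_finite :: "('a, 'k) path_category \<Rightarrow> bool" where
  "row_finite \<Lambda> \<longleftrightarrow> (\<forall>v \<in> vertices \<Lambda>. \<forall>n. finite (with_rng \<Lambda> v (paths_deg \<Lambda> n)))"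

definition locally_convex :: "('a, 'k) path_category \<Rightarrow> bool" where
  "locally_convex \<Lambda> \<longleftrightarrow>
     (\<forall>v \<in> vertices \<Lambda>. \<forall>i j. i \<noteq> j \<longrightarrow>
        (\<forall>x \<in> with_rng \<Lambda> v (paths_deg \<Lambda> (basis_deg i)).
         \<forall>y \<in> with_rng \<Lambda> v (paths_deg \<Lambda> (basis_deg j)).
           with_rng \<Lambda> (src \<Lambda> x) (paths_deg \<Lambda> (basis_deg j)) \<noteq> {} \<and>
           with_rng \<Lambda> (src \<Lambda> y) (paths_deg \<Lambda> (basis_deg i)) \<noteq> {}))"

definition MCE :: "('a, 'k) path_category \<Rightarrow> 'a \<Rightarrow> 'a \<Rightarrow> 'a set" where
  "MCE \<Lambda> \<mu> \<nu> = {x \<in> paths \<Lambda>. degree \<Lambda> x = sup (degree \<Lambda> \<mu>) (degree \<Lambda> \<nu>) \<and>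
     segment \<Lambda> x 0 (degree \<Lambda> \<mu>) = \<mu> \<and> segment \<Lambda> x 0 (degree \<Lambda> \<nu>) = \<nu>}"

definition exhaustive :: "('a, 'k) path_category \<Rightarrow> 'a \<Rightarrow> 'a set \<Rightarrow> bool" where
  "exhaustive \<Lambda> v E \<longleftrightarrow> E \<subseteq> with_rng \<Lambda> v (paths \<Lambda>) \<and>
     (\<forall>\<mu> \<in> with_rng \<Lambda> v (paths \<Lambda>). \<exists>x \<in> E. MCE \<Lambda> \<mu> x \<noteq> {})"

definition finite_exhaustive :: "('a, 'k) path_category \<Rightarrow> 'a \<Rightarrow> 'a set set" where
  "finite_exhaustive \<Lambda> v = {E. finite E \<and> exhaustive \<Lambda> v E}"

definition cofinal_k_graph :: "('a, 'k) path_category \<Rightarrow> bool" where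
  "cofinal_k_graph \<Lambda> \<longleftrightarrow>
     (\<forall>v \<in> vertices \<Lambda>. \<forall>w \<in> vertices \<Lambda>.
        \<exists>E \<in> finite_exhaustive \<Lambda> w. \<forall>\<alpha> \<in> E. paths_between \<Lambda> v (src \<Lambda> \<alpha>) \<noteq> {})"

context k_graph
begin

lemma factorisation_unique:
  assumes "\<mu> \<in> paths \<Lambda>" "\<nu> \<in> paths \<Lambda>" "src \<Lambda> \<mu> = rng \<Lambda> \<nu>"
    and "\<mu>' \<in> paths \<Lambda>" "\<nu>' \<in> paths \<Lambda>" "src \<Lambda> \<mu>' = rng \<Lambda> \<nu>'"
    and "degree \<Lambda> \<mu> = degree \<Lambda> \<mu>'" "degree \<Lambda> \<nu> = degree \<Lambda> \<nu>'" "\<mu> \<cdot> \<nu> = \<mu>' \<cdot> \<nu>'"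
  shows "\<mu> = \<mu>' \<and> \<nu> = \<nu>'"
proof -
  let ?P = "\<lambda>(a, b). a \<in> paths \<Lambda> \<and> b \<in> paths \<Lambda> \<and> src \<Lambda> a = rng \<Lambda> b \<and>
          degree \<Lambda> a = degree \<Lambda> \<mu> \<and> degree \<Lambda> b = degree \<Lambda> \<nu> \<and> \<mu> \<cdot> \<nu> = a \<cdot> b"
  have "\<exists>!p. ?P p"
    using factorisation[of "\<mu> \<cdot> \<nu>" "degree \<Lambda> \<mu>" "degree \<Lambda> \<nu>"] assms comp_closed degree_comp
    by simp
  moreover have "?P (\<mu>, \<nu>)" "?P (\<mu>', \<nu>')" using assms by simp_all
  ultimately have "(\<mu>, \<nu>) = (\<mu>', \<nu>')" by blast
  then show ?thesis by simp
qed

lemma degree_src: "x \<in> paths \<Lambda> \<Longrightarrow> degree \<Lambda> (src \<Lambda> x) = 0"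
  using degree_id[OF src_closed] rng_src by simp

lemma vertex_ids:
  assumes "v \<in> vertices \<Lambda>"
  shows "rng \<Lambda> v = v" "src \<Lambda> v = v"
proof -
  have v: "v \<in> paths \<Lambda>" "degree \<Lambda> v = 0" using assms by (auto simp: paths_deg_def)
  have "rng \<Lambda> v = v \<and> v = src \<Lambda> v"
    by (rule factorisation_unique)
      (use v in \<open>simp_all add: rng_closed src_closed src_rng rng_src degree_id degree_src
          rng_comp_id comp_src_id\<close>)
  then show "rng \<Lambda> v = v" "src \<Lambda> v = v" by simp_all
qed

lemma vertices_eq_identities: "vertices \<Lambda> = rng \<Lambda> ` paths \<Lambda>"
proof
  show "vertices \<Lambda> \<subseteq> rng \<Lambda> ` paths \<Lambda>"
  proof
    fix v assume v: "v \<in> vertices \<Lambda>"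
    then show "v \<in> rng \<Lambda> ` paths \<Lambda>"
      using vertex_ids(1)[OF v] by (auto simp: paths_deg_def intro: image_eqI[of v _ v])
  qed
  show "rng \<Lambda> ` paths \<Lambda> \<subseteq> vertices \<Lambda>"
    by (auto simp: paths_deg_def rng_closed degree_id)
qed

lemma segment_unique:
  assumes x: "x \<in> paths \<Lambda>" and mn: "m \<le> n" "n \<le> degree \<Lambda> x"
  shows "\<exists>!y. y \<in> paths_deg \<Lambda> (n - m) \<and>
     (\<exists>x' \<in> paths_deg \<Lambda> m. \<exists>x'' \<in> paths_deg \<Lambda> (degree \<Lambda> x - n).
        src \<Lambda> x' = rng \<Lambda> y \<and> src \<Lambda> y = rng \<Lambda> x'' \<and> x = x' \<cdot> y \<cdot> x'')"
proof -
  have "degree \<Lambda> x = n + (degree \<Lambda> x - n)" using mn by (auto simp: le_fun_def)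
  from ex1_implies_ex[OF factorisation[OF x this]] obtain a x'' where
    a: "a \<in> paths \<Lambda>" "x'' \<in> paths \<Lambda>" "src \<Lambda> a = rng \<Lambda> x''" "degree \<Lambda> a = n"
      "degree \<Lambda> x'' = degree \<Lambda> x - n" "x = a \<cdot> x''" by auto
  have "degree \<Lambda> a = m + (n - m)" using a mn by (auto simp: le_fun_def)
  from ex1_implies_ex[OF factorisation[OF a(1) this]] obtain x' y where
    b: "x' \<in> paths \<Lambda>" "y \<in> paths \<Lambda>" "src \<Lambda> x' = rng \<Lambda> y" "degree \<Lambda> x' = m"
      "degree \<Lambda> y = n - m" "a = x' \<cdot> y" by auto
  show ?thesis
  proof (rule ex1I[of _ y], goal_cases)
    case 1
    show ?case using a b src_comp[OF b(1-3)] unfolding paths_deg_def by auto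
  next
    case (2 z)
    then obtain w' w'' where w: "z \<in> paths \<Lambda>" "degree \<Lambda> z = n - m"
      "w' \<in> paths \<Lambda>" "degree \<Lambda> w' = m" "w'' \<in> paths \<Lambda>" "degree \<Lambda> w'' = degree \<Lambda> x - n"
      "src \<Lambda> w' = rng \<Lambda> z" "src \<Lambda> z = rng \<Lambda> w''" "x = w' \<cdot> z \<cdot> w''"
      by (auto simp: paths_deg_def)
    have "w' \<cdot> z = a \<and> w'' = x''"
      by (rule factorisation_unique)
        (use w a b in \<open>simp_all add: comp_closed src_comp degree_comp\<close>)
    then have "w' \<cdot> z = x' \<cdot> y" using b by simp
    then have "w' = x' \<and> z = y"
      using w b by (intro factorisation_unique) simp_all
    then show ?case by simp
  qed
qed

end

end

(* Given a finite exhaustive set E at w, let n bound the degrees of its elements.  If \<alpha> in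
   w\<Lambda>^{\<le>n} has a minimal common extension \<alpha>\<beta> = \<lambda>\<gamma> with \<lambda> in E, then \<beta> must be a vertex,
   because \<alpha> cannot be extended in any direction in which its degree is below n.  Hence
   \<alpha> = \<lambda>\<gamma>, and any path from s(\<lambda>) to v prolongs along \<gamma>.
   Conversely w\<Lambda>^{\<le>n} is itself finite and exhaustive: extend \<mu> in w\<Lambda> as far as possible
   towards n \<or> d(\<mu>), and cut the result at n.  By local convexity, an edge of degree e_i at
   the cut would propagate along the remainder, whose degree vanishes at i, to the end of
   the extension, where there is none. *)

theory Submission
  imports Defs "HOL-Library.FuncSet"
begin

context k_graph
begin

section \<open>Initial factors, segments and common extensions\<close>

lemma composite_of_degree_sum:
  assumes "x \<in> paths \<Lambda>" "degree \<Lambda> x = m + n"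
  obtains \<mu> \<nu> where "\<mu> \<in> paths \<Lambda>" "\<nu> \<in> paths \<Lambda>" "src \<Lambda> \<mu> = rng \<Lambda> \<nu>"
    "degree \<Lambda> \<mu> = m" "degree \<Lambda> \<nu> = n" "x = \<mu> \<cdot> \<nu>"
  using ex1_implies_ex[OF factorisation[OF assms]] by auto

lemma initial_factor:
  assumes "x \<in> paths \<Lambda>" "m \<le> degree \<Lambda> x"
  obtains \<mu> \<nu> where "\<mu> \<in> paths \<Lambda>" "\<nu> \<in> paths \<Lambda>" "src \<Lambda> \<mu> = rng \<Lambda> \<nu>"
    "degree \<Lambda> \<mu> = m" "degree \<Lambda> \<nu> = degree \<Lambda> x - m" "x = \<mu> \<cdot> \<nu>"
proof (rule composite_of_degree_sum[OF assms(1)])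
  show "degree \<Lambda> x = m + (degree \<Lambda> x - m)"
    using assms(2) by (auto simp: le_fun_def)
qed (rule that)

lemma rng_in_vertices: "x \<in> paths \<Lambda> \<Longrightarrow> rng \<Lambda> x \<in> vertices \<Lambda>"
  by (simp add: vertices_eq_identities)

lemma src_in_vertices: "x \<in> paths \<Lambda> \<Longrightarrow> src \<Lambda> x \<in> vertices \<Lambda>"
  by (simp add: paths_deg_def src_closed degree_src)

text \<open>The vertex \<open>rng \<Lambda> \<mu>\<close> serves as the degree 0 factor and \<nu> as
  the tail, so \<mu> fits the description that \<open>segment_unique\<close> shows to have one
  solution.\<close>

lemma segment_0_comp:
  assumes "\<mu> \<in> paths \<Lambda>" "\<nu> \<in> paths \<Lambda>" "src \<Lambda> \<mu> = rng \<Lambda> \<nu>"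
  shows "segment \<Lambda> (\<mu> \<cdot> \<nu>) 0 (degree \<Lambda> \<mu>) = \<mu>"
  unfolding segment_def
proof (rule the1_equality[OF segment_unique])
  show "\<mu> \<cdot> \<nu> \<in> paths \<Lambda>" using assms by (rule comp_closed)
  show "0 \<le> degree \<Lambda> \<mu>" by (simp add: le_fun_def)
  show "degree \<Lambda> \<mu> \<le> degree \<Lambda> (\<mu> \<cdot> \<nu>)"
    using assms by (simp add: degree_comp le_fun_def)
  have "rng \<Lambda> \<mu> \<in> paths_deg \<Lambda> 0"
    using assms rng_in_vertices by simp
  moreover have "\<nu> \<in> paths_deg \<Lambda> (degree \<Lambda> (\<mu> \<cdot> \<nu>) - degree \<Lambda> \<mu>)"
    using assms by (auto simp: paths_deg_def degree_comp)
  ultimately show "\<mu> \<in> paths_deg \<Lambda> (degree \<Lambda> \<mu> - 0) \<and>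
     (\<exists>x' \<in> paths_deg \<Lambda> 0. \<exists>x'' \<in> paths_deg \<Lambda> (degree \<Lambda> (\<mu> \<cdot> \<nu>) - degree \<Lambda> \<mu>).
        src \<Lambda> x' = rng \<Lambda> \<mu> \<and> src \<Lambda> \<mu> = rng \<Lambda> x'' \<and> \<mu> \<cdot> \<nu> = x' \<cdot> \<mu> \<cdot> x'')"
    using assms by (intro conjI bexI[of _ "rng \<Lambda> \<mu>"] bexI[of _ \<nu>])
      (auto simp: paths_deg_def src_rng rng_comp_id fun_eq_iff)
qed

text \<open>Converse of \<open>segment_0_comp\<close>. That \<mu> is a path is part of the
  conclusion: it is identified with the initial factor of \<open>x\<close> of its degree.\<close>

lemma segment_0_eqE:
  assumes "x \<in> paths \<Lambda>" "degree \<Lambda> \<mu> \<le> degree \<Lambda> x" "segment \<Lambda> x 0 (degree \<Lambda> \<mu>) = \<mu>"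
  obtains \<nu> where "\<mu> \<in> paths \<Lambda>" "\<nu> \<in> paths \<Lambda>" "src \<Lambda> \<mu> = rng \<Lambda> \<nu>"
    "degree \<Lambda> \<nu> = degree \<Lambda> x - degree \<Lambda> \<mu>" "x = \<mu> \<cdot> \<nu>"
proof (rule initial_factor[OF assms(1,2)])
  fix a b
  assume ab: "a \<in> paths \<Lambda>" "b \<in> paths \<Lambda>" "src \<Lambda> a = rng \<Lambda> b"
    "degree \<Lambda> a = degree \<Lambda> \<mu>" "degree \<Lambda> b = degree \<Lambda> x - degree \<Lambda> \<mu>" "x = a \<cdot> b"
  then have "a = \<mu>" using segment_0_comp[of a b] assms(3) by simp
  with ab that show thesis by blast
qed

text \<open>A common extension need not be minimal: cutting it at the join of the two degrees leaves
  a path that still begins with both \<mu> and \<nu>.\<close>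

lemma MCE_nonempty:
  assumes "x \<in> paths \<Lambda>" and \<mu>: "\<mu> \<in> paths \<Lambda>" "\<mu>' \<in> paths \<Lambda>" "src \<Lambda> \<mu> = rng \<Lambda> \<mu>'" "x = \<mu> \<cdot> \<mu>'"
    and \<nu>: "\<nu> \<in> paths \<Lambda>" "\<nu>' \<in> paths \<Lambda>" "src \<Lambda> \<nu> = rng \<Lambda> \<nu>'" "x = \<nu> \<cdot> \<nu>'"
  shows "MCE \<Lambda> \<mu> \<nu> \<noteq> {}"
proof -
  let ?m = "sup (degree \<Lambda> \<mu>) (degree \<Lambda> \<nu>)"
  have "degree \<Lambda> \<mu> \<le> degree \<Lambda> x"
    unfolding \<mu>(4) by (simp add: degree_comp[OF \<mu>(1-3)] le_fun_def)
  moreover have "degree \<Lambda> \<nu> \<le> degree \<Lambda> x"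
    unfolding \<nu>(4) by (simp add: degree_comp[OF \<nu>(1-3)] le_fun_def)
  ultimately have "?m \<le> degree \<Lambda> x" by simp
  then obtain y z where y: "y \<in> paths \<Lambda>" "z \<in> paths \<Lambda>" "src \<Lambda> y = rng \<Lambda> z"
      "degree \<Lambda> y = ?m" "x = y \<cdot> z"
    using initial_factor[OF assms(1)] by metis
  have *: "segment \<Lambda> y 0 (degree \<Lambda> \<kappa>) = \<kappa>"
    if \<kappa>: "\<kappa> \<in> paths \<Lambda>" "\<kappa>' \<in> paths \<Lambda>" "src \<Lambda> \<kappa> = rng \<Lambda> \<kappa>'" "x = \<kappa> \<cdot> \<kappa>'" "degree \<Lambda> \<kappa> \<le> ?m" for \<kappa> \<kappa>'
  proof -
    obtain a b where ab: "a \<in> paths \<Lambda>" "b \<in> paths \<Lambda>" "src \<Lambda> a = rng \<Lambda> b"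
        "degree \<Lambda> a = degree \<Lambda> \<kappa>" "y = a \<cdot> b"
      using initial_factor[OF y(1), of "degree \<Lambda> \<kappa>"] \<kappa>(5) y(4) by metis
    have bz: "src \<Lambda> b = rng \<Lambda> z" using ab y src_comp by metis
    have bz': "b \<cdot> z \<in> paths \<Lambda>" "src \<Lambda> a = rng \<Lambda> (b \<cdot> z)"
      using ab y bz by (simp_all add: comp_closed rng_comp)
    have x: "x = a \<cdot> (b \<cdot> z)" using ab y bz comp_assoc by metis
    \<comment> \<open>Both \<open>a\<close> and \<kappa> are the initial segment of the same degree
      of \<open>x\<close>, once through \<open>y\<close> and once directly.\<close>
    have "a = \<kappa>"
      using segment_0_comp[OF ab(1) bz'] segment_0_comp[OF \<kappa>(1-3)] x \<kappa>(4) ab(4) by metis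
    then show ?thesis using segment_0_comp[OF ab(1-3)] ab by simp
  qed
  have "y \<in> MCE \<Lambda> \<mu> \<nu>"
    unfolding MCE_def using y *[OF \<mu>] *[OF \<nu>] by simp
  then show ?thesis by blast
qed

lemma MCE_E:
  assumes "x \<in> MCE \<Lambda> \<mu> \<nu>"
  obtains \<beta> \<gamma> where "\<mu> \<in> paths \<Lambda>" "\<nu> \<in> paths \<Lambda>" "\<beta> \<in> paths \<Lambda>" "\<gamma> \<in> paths \<Lambda>"
    "src \<Lambda> \<mu> = rng \<Lambda> \<beta>" "src \<Lambda> \<nu> = rng \<Lambda> \<gamma>" "\<mu> \<cdot> \<beta> = \<nu> \<cdot> \<gamma>"
    "degree \<Lambda> \<beta> = sup (degree \<Lambda> \<mu>) (degree \<Lambda> \<nu>) - degree \<Lambda> \<mu>"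
proof -
  have x: "x \<in> paths \<Lambda>" "degree \<Lambda> x = sup (degree \<Lambda> \<mu>) (degree \<Lambda> \<nu>)"
    "segment \<Lambda> x 0 (degree \<Lambda> \<mu>) = \<mu>" "segment \<Lambda> x 0 (degree \<Lambda> \<nu>) = \<nu>"
    using assms by (auto simp: MCE_def)
  have le: "degree \<Lambda> \<mu> \<le> degree \<Lambda> x" "degree \<Lambda> \<nu> \<le> degree \<Lambda> x" using x(2) by simp_all
  show thesis
    by (rule segment_0_eqE[OF x(1) le(1) x(3)], rule segment_0_eqE[OF x(1) le(2) x(4)])
      (rule that, assumption+, use x(2) in simp_all)
qed

section \<open>Edges and local convexity\<close>

lemma edge_at_range:
  assumes "x \<in> paths \<Lambda>" "degree \<Lambda> x i > 0"
  obtains e f where "e \<in> with_rng \<Lambda> (rng \<Lambda> x) (paths_deg \<Lambda> (basis_deg i))"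
    "f \<in> paths \<Lambda>" "src \<Lambda> e = rng \<Lambda> f" "degree \<Lambda> f = degree \<Lambda> x - basis_deg i" "x = e \<cdot> f"
proof -
  have "basis_deg i \<le> degree \<Lambda> x"
    using assms(2) by (auto simp: basis_deg_def le_fun_def)
  then show thesis
    by (rule initial_factor[OF assms(1)])
      (rule that, auto simp: with_rng_def paths_deg_def rng_comp)
qed

text \<open>Induction on the total degree. The first edge of \<open>x\<close> has some degree
  \<open>basis_deg j\<close> with \<open>j\<close> different from \<open>i\<close>, so local
  convexity carries the edge of degree \<open>basis_deg i\<close> from its range to its source,
  where the rest of \<open>x\<close> begins.\<close>

lemma edge_propagates:
  assumes "locally_convex \<Lambda>"
    and "x \<in> paths \<Lambda>" "degree \<Lambda> x i = 0"
    and "with_rng \<Lambda> (rng \<Lambda> x) (paths_deg \<Lambda> (basis_deg i)) \<noteq> {}"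
  shows "with_rng \<Lambda> (src \<Lambda> x) (paths_deg \<Lambda> (basis_deg i)) \<noteq> {}"
  using assms(2-)
proof (induction "sum (degree \<Lambda> x) UNIV" arbitrary: x rule: less_induct)
  case less
  show ?case
  proof (cases "degree \<Lambda> x = 0")
    case True
    with less.prems have "rng \<Lambda> x = x" "src \<Lambda> x = x"
      by (auto intro!: vertex_ids simp: paths_deg_def)
    with less.prems show ?thesis by simp
  next
    case False
    then obtain j where j: "degree \<Lambda> x j > 0" by (auto simp: fun_eq_iff)
    with less.prems have ij: "i \<noteq> j" by auto
    obtain e f where ef: "e \<in> with_rng \<Lambda> (rng \<Lambda> x) (paths_deg \<Lambda> (basis_deg j))"
        "f \<in> paths \<Lambda>" "src \<Lambda> e = rng \<Lambda> f" "degree \<Lambda> f = degree \<Lambda> x - basis_deg j" "x = e \<cdot> f"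
      using edge_at_range[of x j] less.prems(1) j by metis
    have e: "e \<in> paths \<Lambda>" using ef by (auto simp: with_rng_def paths_deg_def)
    have "with_rng \<Lambda> (rng \<Lambda> f) (paths_deg \<Lambda> (basis_deg i)) \<noteq> {}"
      using assms(1) less.prems(1,3) ij ef(1,3) rng_in_vertices[OF less.prems(1)]
      unfolding locally_convex_def by (metis ex_in_conv)
    moreover have "sum (degree \<Lambda> f) UNIV < sum (degree \<Lambda> x) UNIV"
      by (rule sum_strict_mono_ex1) (use j in \<open>auto simp: ef(4) basis_deg_def intro!: exI[of _ j]\<close>)
    moreover have "degree \<Lambda> f i = 0" using ef(4) less.prems(2) by simp
    ultimately have "with_rng \<Lambda> (src \<Lambda> f) (paths_deg \<Lambda> (basis_deg i)) \<noteq> {}"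
      using less.hyps ef(2) by blast
    then show ?thesis using src_comp[OF e ef(2,3)] ef(5) by simp
  qed
qed

section \<open>The sets of paths that are maximal below a degree\<close>

text \<open>Among the paths with range \<open>v\<close> and degree at most \<open>n\<close>, one of
  greatest total degree works: an edge at its source in a direction still below \<open>n\<close>
  would give a longer one.\<close>

lemma paths_le_nonempty:
  assumes "v \<in> vertices \<Lambda>"
  obtains x where "x \<in> with_rng \<Lambda> v (paths_le \<Lambda> n)"
proof -
  let ?P = "\<lambda>x. x \<in> paths \<Lambda> \<and> rng \<Lambda> x = v \<and> degree \<Lambda> x \<le> n"
  let ?s = "\<lambda>x. sum (degree \<Lambda> x) UNIV"
  have "?P v" using assms vertex_ids[OF assms] by (auto simp: paths_deg_def le_fun_def)
  moreover have "\<forall>y. ?P y \<longrightarrow> ?s y < Suc (sum n UNIV)"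
    by (auto simp: less_Suc_eq_le le_fun_def intro!: sum_mono)
  ultimately obtain x where x: "?P x" and max: "\<And>y. ?P y \<Longrightarrow> ?s y \<le> ?s x"
    using ex_has_greatest_nat[of ?P v ?s] by (metis (no_types, lifting))
  have "with_rng \<Lambda> (src \<Lambda> x) (paths_deg \<Lambda> (basis_deg i)) = {}" if i: "degree \<Lambda> x i < n i" for i
  proof (rule ccontr)
    assume "with_rng \<Lambda> (src \<Lambda> x) (paths_deg \<Lambda> (basis_deg i)) \<noteq> {}"
    then obtain e where e: "e \<in> paths \<Lambda>" "src \<Lambda> x = rng \<Lambda> e" "degree \<Lambda> e = basis_deg i"
      by (auto simp: with_rng_def paths_deg_def)
    have d: "degree \<Lambda> (x \<cdot> e) = degree \<Lambda> x + basis_deg i" using x e by (simp add: degree_comp)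
    have "?P (x \<cdot> e)"
      using x e i by (auto simp: comp_closed rng_comp degree_comp basis_deg_def le_fun_def Suc_le_eq)
    then have "?s (x \<cdot> e) \<le> ?s x" by (rule max)
    then show False by (simp add: d sum.distrib basis_deg_def)
  qed
  then have "x \<in> with_rng \<Lambda> v (paths_le \<Lambda> n)" using x by (auto simp: with_rng_def paths_le_def)
  then show thesis by (rule that)
qed

lemma finite_paths_le:
  assumes "row_finite \<Lambda>" "v \<in> vertices \<Lambda>"
  shows "finite (with_rng \<Lambda> v (paths_le \<Lambda> n))"
proof (rule finite_subset)
  show "with_rng \<Lambda> v (paths_le \<Lambda> n) \<subseteq> (\<Union>m \<in> {..n}. with_rng \<Lambda> v (paths_deg \<Lambda> m))"
    by (auto simp: with_rng_def paths_le_def paths_deg_def)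
  have "finite {..n}"
  proof (rule finite_subset)
    \<comment> \<open>The degrees below \<open>n\<close> form a box, which is finite because the
      index type is.\<close>
    show "{..n} \<subseteq> (\<Pi>\<^sub>E i \<in> UNIV. {..n i})" by (auto simp: le_fun_def)
  qed (simp add: finite_PiE)
  then show "finite (\<Union>m \<in> {..n}. with_rng \<Lambda> v (paths_deg \<Lambda> m))"
    using assms by (auto simp: row_finite_def)
qed

lemma exhaustive_paths_le:
  assumes "locally_convex \<Lambda>"
  shows "exhaustive \<Lambda> v (with_rng \<Lambda> v (paths_le \<Lambda> n))"
  unfolding exhaustive_def
proof (intro conjI ballI)
  show "with_rng \<Lambda> v (paths_le \<Lambda> n) \<subseteq> with_rng \<Lambda> v (paths \<Lambda>)"
    by (auto simp: with_rng_def paths_le_def)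
next
  fix \<mu> assume "\<mu> \<in> with_rng \<Lambda> v (paths \<Lambda>)"
  then have \<mu>: "\<mu> \<in> paths \<Lambda>" "rng \<Lambda> \<mu> = v" by (auto simp: with_rng_def)
  \<comment> \<open>The subtraction truncates at 0, so the extension aims at the join of
    \<open>n\<close> and the degree of \<mu>, and adds nothing where \<mu> already reaches
    \<open>n\<close>.\<close>
  obtain \<nu> where "\<nu> \<in> with_rng \<Lambda> (src \<Lambda> \<mu>) (paths_le \<Lambda> (n - degree \<Lambda> \<mu>))"
    using paths_le_nonempty[OF src_in_vertices[OF \<mu>(1)]] by blast
  then have \<nu>: "\<nu> \<in> paths \<Lambda>" "src \<Lambda> \<mu> = rng \<Lambda> \<nu>"
    and no_edge: "\<And>i. degree \<Lambda> \<nu> i < n i - degree \<Lambda> \<mu> i \<Longrightarrow>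
      with_rng \<Lambda> (src \<Lambda> \<nu>) (paths_deg \<Lambda> (basis_deg i)) = {}"
    by (auto simp: with_rng_def paths_le_def)
  let ?x = "\<mu> \<cdot> \<nu>"
  have x: "?x \<in> paths \<Lambda>" "degree \<Lambda> ?x = degree \<Lambda> \<mu> + degree \<Lambda> \<nu>" "src \<Lambda> ?x = src \<Lambda> \<nu>"
      "rng \<Lambda> ?x = v"
    using \<mu> \<nu> by (simp_all add: comp_closed degree_comp src_comp rng_comp)
  \<comment> \<open>The extension may fall short of \<open>n\<close> in some directions, so the cut
    is at the meet. Where \<open>a\<close> stays below \<open>n\<close> it has used up the whole
    degree of the extension, and the remainder \<open>b\<close> has degree 0 there.\<close>
  obtain a b where ab: "a \<in> paths \<Lambda>" "b \<in> paths \<Lambda>" "src \<Lambda> a = rng \<Lambda> b"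
      "degree \<Lambda> a = inf n (degree \<Lambda> ?x)" "degree \<Lambda> b = degree \<Lambda> ?x - inf n (degree \<Lambda> ?x)"
      "?x = a \<cdot> b"
    using initial_factor[OF x(1), of "inf n (degree \<Lambda> ?x)"] by auto
  have "with_rng \<Lambda> (src \<Lambda> a) (paths_deg \<Lambda> (basis_deg i)) = {}" if "degree \<Lambda> a i < n i" for i
  proof -
    have i: "degree \<Lambda> ?x i < n i" using that ab(4) by (auto simp: inf_nat_def min_def split: if_splits)
    then have "degree \<Lambda> b i = 0" using ab(5) by (simp add: inf_nat_def)
    moreover have "src \<Lambda> b = src \<Lambda> \<nu>" using x(3) ab src_comp by metis
    moreover have "degree \<Lambda> \<nu> i < n i - degree \<Lambda> \<mu> i" using i x(2) by simp
    ultimately show ?thesis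
      using edge_propagates[OF assms ab(2)] no_edge ab(3) by metis
  qed
  then have "a \<in> with_rng \<Lambda> v (paths_le \<Lambda> n)"
    using ab x(4) rng_comp[OF ab(1-3)] by (auto simp: with_rng_def paths_le_def)
  moreover have "MCE \<Lambda> \<mu> a \<noteq> {}"
    by (rule MCE_nonempty[OF x(1) \<mu>(1) \<nu> refl ab(1-3,6)])
  ultimately show "\<exists>y \<in> with_rng \<Lambda> v (paths_le \<Lambda> n). MCE \<Lambda> \<mu> y \<noteq> {}" by blast
qed

lemma paths_le_factors_through_exhaustive:
  assumes "exhaustive \<Lambda> w E" "\<And>x. x \<in> E \<Longrightarrow> degree \<Lambda> x \<le> n"
    and "\<alpha> \<in> with_rng \<Lambda> w (paths_le \<Lambda> n)"
  obtains x \<gamma> where "x \<in> E" "x \<in> paths \<Lambda>" "\<gamma> \<in> paths \<Lambda>" "src \<Lambda> x = rng \<Lambda> \<gamma>" "\<alpha> = x \<cdot> \<gamma>"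
proof -
  have "\<alpha> \<in> with_rng \<Lambda> w (paths \<Lambda>)" using assms(3) by (auto simp: with_rng_def paths_le_def)
  then obtain x y where x: "x \<in> E" "y \<in> MCE \<Lambda> \<alpha> x"
    using assms(1) unfolding exhaustive_def by blast
  from x(2) obtain \<beta> \<gamma> where bc: "\<alpha> \<in> paths \<Lambda>" "x \<in> paths \<Lambda>" "\<beta> \<in> paths \<Lambda>" "\<gamma> \<in> paths \<Lambda>"
      "src \<Lambda> \<alpha> = rng \<Lambda> \<beta>" "src \<Lambda> x = rng \<Lambda> \<gamma>" "\<alpha> \<cdot> \<beta> = x \<cdot> \<gamma>"
      "degree \<Lambda> \<beta> = sup (degree \<Lambda> \<alpha>) (degree \<Lambda> x) - degree \<Lambda> \<alpha>"
    by (rule MCE_E)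
  \<comment> \<open>A positive coordinate of \<beta> means that \<alpha> falls short of
    \<open>x\<close>, hence of \<open>n\<close>, in that direction; but then \<beta> would begin
    with an edge that \<open>paths_le\<close> forbids at the source of \<alpha>.\<close>
  have "degree \<Lambda> \<beta> i = 0" for i
  proof (rule ccontr)
    assume *: "degree \<Lambda> \<beta> i \<noteq> 0"
    then have "degree \<Lambda> \<alpha> i < degree \<Lambda> x i" by (simp add: bc(8) sup_nat_def)
    also have "\<dots> \<le> n i" using assms(2)[OF x(1)] by (simp add: le_fun_def)
    finally have "with_rng \<Lambda> (rng \<Lambda> \<beta>) (paths_deg \<Lambda> (basis_deg i)) = {}"
      using assms(3) bc(5) by (auto simp: with_rng_def paths_le_def)
    then show False using edge_at_range[OF bc(3), of i] * by auto
  qed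
  then have "\<beta> \<in> vertices \<Lambda>" using bc(3) by (auto simp: paths_deg_def)
  then have "\<alpha> \<cdot> \<beta> = \<alpha>" using vertex_ids(1) bc(1,5) comp_src_id by metis
  then show thesis using that[OF x(1) bc(2,4,6)] bc(7) by simp
qed

end

theorem propositionA2:
  fixes \<Lambda> :: "('a, 'k::finite) path_category"
  assumes "k_graph \<Lambda>"
    and "row_finite \<Lambda>"
    and "locally_convex \<Lambda>"
  shows "cofinal_k_graph \<Lambda> \<longleftrightarrow>
    (\<forall>v \<in> vertices \<Lambda>. \<forall>w \<in> vertices \<Lambda>. \<exists>n :: 'k \<Rightarrow> nat.
       \<forall>\<alpha> \<in> with_rng \<Lambda> w (paths_le \<Lambda> n). paths_between \<Lambda> v (src \<Lambda> \<alpha>) \<noteq> {})"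
proof -
  interpret k_graph \<Lambda> by fact
  show ?thesis
  proof (intro iffI ballI)
    fix v w
    assume cof: "cofinal_k_graph \<Lambda>" and vw: "v \<in> vertices \<Lambda>" "w \<in> vertices \<Lambda>"
    from cof[unfolded cofinal_k_graph_def, rule_format, OF vw] obtain E
      where E: "finite E" "exhaustive \<Lambda> w E"
        "\<And>x. x \<in> E \<Longrightarrow> paths_between \<Lambda> v (src \<Lambda> x) \<noteq> {}"
      by (auto simp: finite_exhaustive_def)
    \<comment> \<open>Any common upper bound of the degrees in \<open>E\<close> would do; the sum
      also makes sense for empty \<open>E\<close>.\<close>
    let ?n = "\<lambda>i. \<Sum>x\<in>E. degree \<Lambda> x i"
    have n: "degree \<Lambda> x \<le> ?n" if "x \<in> E" for x
      using member_le_sum[of x E "\<lambda>x. degree \<Lambda> x _"] that E(1) by (auto simp: le_fun_def)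
    have "paths_between \<Lambda> v (src \<Lambda> \<alpha>) \<noteq> {}" if \<alpha>: "\<alpha> \<in> with_rng \<Lambda> w (paths_le \<Lambda> ?n)" for \<alpha>
    proof -
      obtain x \<gamma> where x: "x \<in> E" "x \<in> paths \<Lambda>" "\<gamma> \<in> paths \<Lambda>" "src \<Lambda> x = rng \<Lambda> \<gamma>"
          "\<alpha> = path_comp \<Lambda> x \<gamma>"
        using paths_le_factors_through_exhaustive[OF E(2) n \<alpha>] by blast
      obtain t where "t \<in> paths \<Lambda>" "rng \<Lambda> t = v" "src \<Lambda> t = src \<Lambda> x"
        using E(3)[OF x(1)] by (auto simp: paths_between_def)
      \<comment> \<open>Since \<open>t\<close> and \<open>x\<close> have the same source,
        \<open>t\<close> can replace \<open>x\<close> in front of \<gamma>, which ends where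
        \<alpha> does.\<close>
      then have "path_comp \<Lambda> t \<gamma> \<in> paths_between \<Lambda> v (src \<Lambda> \<alpha>)"
        using x by (simp add: paths_between_def comp_closed rng_comp src_comp)
      then show ?thesis by blast
    qed
    then show "\<exists>n. \<forall>\<alpha> \<in> with_rng \<Lambda> w (paths_le \<Lambda> n). paths_between \<Lambda> v (src \<Lambda> \<alpha>) \<noteq> {}"
      by blast
  next
    assume "\<forall>v \<in> vertices \<Lambda>. \<forall>w \<in> vertices \<Lambda>. \<exists>n. \<forall>\<alpha> \<in> with_rng \<Lambda> w (paths_le \<Lambda> n).
      paths_between \<Lambda> v (src \<Lambda> \<alpha>) \<noteq> {}"
    \<comment> \<open>This holds for every \<open>n\<close>, so the set belonging to the given
      \<open>n\<close> is itself the witness for cofinality.\<close>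
    moreover have "with_rng \<Lambda> w (paths_le \<Lambda> n) \<in> finite_exhaustive \<Lambda> w"
      if "w \<in> vertices \<Lambda>" for w n
      using finite_paths_le[OF assms(2) that] exhaustive_paths_le[OF assms(3)]
      by (simp add: finite_exhaustive_def)
    ultimately show "cofinal_k_graph \<Lambda>"
      unfolding cofinal_k_graph_def by meson
  qed
qed

end
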